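(* Let $\mathcal{P}$ be a hereditary property of ordered graphs. If $|\mathcal{P}_k| < k$ for some integer $k \geqslant 136$, then $|\mathcal{P}_n| \leqslant |\mathcal{P}_k|$ for every integer $n \geqslant k$.
   Context: An ordered graph is a graph together with a linear order on its vertex set; an ordered graph with $n$ vertices is identified with one on $[n]$ with the usual order. A hereditary property of ordered graphs is a collection $\mathcal{P}$ of ordered graphs closed under taking induced ordered subgraphs (with the inherited order). $\mathcal{P}_n$ denotes the set of ordered graphs in $\mathcal{P}$ with vertex set $[n]$. *)

theory Defs
  imports "Graph_Theory.Graph_Theory"
begin

text \<open>
  An ordered graph is a pair of a finite simple graph (\<^locale>\<open>pair_graph\<close>: finite vertex set,
  irreflexive symmetric adjacency relation) and a (reflexive) linear order on its vertex set.
  Every finite ordered graph has an isomorphic copy whose vertices are natural numbers, so a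
  property of ordered graphs is taken to be a set of ordered graphs over \<^typ>\<open>nat\<close>.
\<close>

type_synonym 'a ordered_graph = "'a pair_pre_digraph \<times> 'a rel"

definition is_ordered_graph :: "'a ordered_graph \<Rightarrow> bool" where
  "is_ordered_graph X \<longleftrightarrow>
     (case X of (G, r) \<Rightarrow> pair_graph G \<and> linear_order_on (pverts G) r)"

definition ordered_graph_iso :: "'a ordered_graph \<Rightarrow> 'b ordered_graph \<Rightarrow> bool" where
  "ordered_graph_iso X Y \<longleftrightarrow>
     (case (X, Y) of ((G, r), (H, s)) \<Rightarrow>
       \<exists>f. bij_betw f (pverts G) (pverts H) \<and>
           (\<forall>u \<in> pverts G. \<forall>v \<in> pverts G.
              ((u, v) \<in> parcs G \<longleftrightarrow> (f u, f v) \<in> parcs H) \<and>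
              ((u, v) \<in> r \<longleftrightarrow> (f u, f v) \<in> s)))"

definition induced_ordered_subgraph :: "'a ordered_graph \<Rightarrow> 'a ordered_graph \<Rightarrow> bool" where
  "induced_ordered_subgraph Y X \<longleftrightarrow>
     (case (Y, X) of ((H, s), (G, r)) \<Rightarrow>
       induced_subgraph (with_proj H) (with_proj G) \<and> s = Restr r (pverts H))"

text \<open>
  Closure under isomorphism expresses that ordered graphs are considered up to isomorphism,
  i.e. that an ordered graph with \<open>n\<close> vertices is identified with its copy on \<open>{1..n}\<close>.
\<close>

definition hereditary_property :: "nat ordered_graph set \<Rightarrow> bool" where
  "hereditary_property P \<longleftrightarrow>
     (\<forall>X \<in> P. is_ordered_graph X) \<and>
     (\<forall>X \<in> P. \<forall>Y. is_ordered_graph Y \<and> ordered_graph_iso X Y \<longrightarrow> Y \<in> P) \<and>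
     (\<forall>X \<in> P. \<forall>Y. induced_ordered_subgraph Y X \<longrightarrow> Y \<in> P)"

definition level :: "nat ordered_graph set \<Rightarrow> nat \<Rightarrow> nat ordered_graph set" where
  "level P n =
     {X \<in> P. pverts (fst X) = {1..n} \<and> snd X = {(i, j). i \<in> {1..n} \<and> j \<in> {1..n} \<and> i \<le> j}}"

text \<open>The levels are finite, so \<^const>\<open>card\<close> counts them properly.\<close>

lemma finite_level:
  assumes "hereditary_property P"
  shows "finite (level P n)"
proof (rule finite_subset)
  let ?S = "(\<lambda>E. (\<lparr>pverts = {1..n}, parcs = E\<rparr>,
                   {(i, j). i \<in> {1..n} \<and> j \<in> {1..n} \<and> i \<le> j})) ` Pow ({1..n} \<times> {1..n})"
  show "finite ?S" by simp
  show "level P n \<subseteq> ?S"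
  proof
    fix X assume X: "X \<in> level P n"
    obtain G r where Gr: "X = (G, r)" by (cases X)
    have "is_ordered_graph X"
      using X assms by (auto simp: level_def hereditary_property_def)
    then interpret pair_graph G by (simp add: Gr is_ordered_graph_def)
    have "parcs G \<subseteq> {1..n} \<times> {1..n}"
      using X in_arcsD1 in_arcsD2 by (force simp: Gr level_def)
    moreover have "G = \<lparr>pverts = {1..n}, parcs = parcs G\<rparr>"
      using X by (simp add: Gr level_def)
    ultimately show "X \<in> ?S"
      using X unfolding Gr level_def by (intro image_eqI[of _ _ "parcs G"]) auto
  qed
qed

end

theory Submission
  imports Defs "HOL-Library.Product_Lexorder"
begin

text \<open>
  It suffices to go from level \<open>m\<close> to level \<open>m + 1\<close>. Let \<open>F\<close> be the set of graphs on
  \<open>{1..m+1}\<close> in the property, each given by its edge set, and let \<open>T\<close> be the set of graphs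
  obtained from them by deleting a vertex. If for some vertex \<open>w\<close> the deletion of \<open>w\<close> is injective
  on \<open>F\<close>, then \<open>|F| \<le> |T|\<close>. Otherwise every vertex \<open>w\<close> has two graphs in \<open>F\<close> that differ only in
  edges at \<open>w\<close>. Order the pairs of vertices lexicographically and let \<open>B(F)\<close> be the set of the
  largest elements of the symmetric differences of two members of \<open>F\<close>; then \<open>B(F)\<close>, as a set
  of edges, covers every vertex. Deleting vertices preserves the lexicographic order, so the pairs
  obtained from \<open>B(F)\<close> by deletions lie in \<open>B(T)\<close>. There are at least \<open>m - 1\<close> of them,
  and \<open>|B(T)| < |T|\<close> since the elements of \<open>B(T)\<close> index branchings of a binary
  tree with leaf set \<open>T\<close>. Hence \<open>|T| \<ge> m\<close>, contrary to \<open>|T| \<le> |P\<^sub>m| < m\<close>.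
\<close>

section \<open>Branching coordinates of a set family\<close>

text \<open>This says that \<open>e\<close> is the maximum of the symmetric difference of
  \<open>X\<close> and \<open>Y\<close>; the pointwise form passes directly to preimages under
  increasing maps, as in \<open>splits_del\<close>.\<close>

definition splits :: "'a::linorder \<Rightarrow> 'a set \<Rightarrow> 'a set \<Rightarrow> bool" where
  "splits e X Y \<longleftrightarrow> (e \<in> X) \<noteq> (e \<in> Y) \<and> (\<forall>e'>e. e' \<in> X \<longleftrightarrow> e' \<in> Y)"

definition branch :: "'a::linorder set set \<Rightarrow> 'a set" where
  "branch T = {e. \<exists>X\<in>T. \<exists>Y\<in>T. splits e X Y}"

lemma splits_sym: "splits e X Y \<Longrightarrow> splits e Y X"
  by (auto simp: splits_def)

lemma splits_irrefl: "\<not> splits e X X"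
  by (simp add: splits_def)

text \<open>\<open>X\<close> and \<open>Y\<close> agree at \<open>e'\<close> and above, so
  \<open>Y\<close> can replace \<open>X\<close> there.\<close>

lemma splits_trans:
  assumes "splits e X Y" "splits e' X Z" "e < e'"
  shows "splits e' Y Z"
  using assms by (auto simp: splits_def)

lemma splits_ex:
  assumes "finite X" "finite Y" "X \<noteq> Y"
  shows "\<exists>e. splits e X Y"
proof -
  let ?D = "(X - Y) \<union> (Y - X)"
  have D: "finite ?D" "?D \<noteq> {}"
    using assms by auto
  have "splits (Max ?D) X Y"
    unfolding splits_def
  proof (intro conjI allI impI)
    show "(Max ?D \<in> X) \<noteq> (Max ?D \<in> Y)"
      using Max_in[OF D] by blast
    show "(e \<in> X) = (e \<in> Y)" if "e > Max ?D" for e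
      using Max_ge[OF D(1), of e] that by fastforce
  qed
  then show ?thesis ..
qed

lemma branch_insert: "branch (insert X T) = branch T \<union> {e. \<exists>Y\<in>T. splits e X Y}"
  unfolding branch_def by (auto simp: splits_irrefl dest: splits_sym)

text \<open>Each set added to a nonempty family creates at most one new branching
  coordinate.\<close>

lemma card_branch_less:
  fixes T :: "'a::wellorder set set"
  assumes "finite T" "T \<noteq> {}"
  shows "finite (branch T) \<and> card (branch T) < card T"
  using assms
proof (induction T rule: finite_ne_induct)
  case (singleton X)
  then show ?case by (simp add: branch_def splits_irrefl)
next
  case (insert X T)
  have "\<exists>e. branch (insert X T) \<subseteq> insert e (branch T)"
  proof (cases "\<exists>e. \<exists>Y\<in>T. splits e X Y")
    case False
    then show ?thesis by (auto simp: branch_insert)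
  next
    case True
    \<comment> \<open>The least coordinate is chosen because any larger \<open>e'\<close> that
      splits \<open>X\<close> from some \<open>Z\<close> also splits \<open>Y\<close> from
      \<open>Z\<close>, and so already lies in \<open>branch T\<close>.\<close>
    define e where "e = (LEAST e. \<exists>Y\<in>T. splits e X Y)"
    have "\<exists>Y\<in>T. splits e X Y"
      unfolding e_def by (rule LeastI_ex[OF True])
    then obtain Y where Y: "Y \<in> T" "splits e X Y" ..
    have "e' \<in> insert e (branch T)" if Z: "Z \<in> T" "splits e' X Z" for e' Z
    proof (cases "e' = e")
      case False
      have "e \<le> e'"
        unfolding e_def using Z by (intro Least_le) blast
      with False have "splits e' Y Z"
        using splits_trans[OF Y(2) Z(2)] by simp
      then show ?thesis
        using Y(1) Z(1) by (auto simp: branch_def)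
    qed simp
    then have "branch (insert X T) \<subseteq> insert e (branch T)"
      by (auto simp: branch_insert)
    then show ?thesis ..
  qed
  then obtain e where e: "branch (insert X T) \<subseteq> insert e (branch T)" ..
  have fin: "finite (insert e (branch T))"
    using insert.IH by simp
  have "card (branch (insert X T)) \<le> card (insert e (branch T))"
    by (rule card_mono[OF fin e])
  also have "\<dots> \<le> Suc (card (branch T))"
    using insert.IH by (simp add: card_insert_if)
  finally show ?case
    using insert finite_subset[OF e fin] by simp
qed

section \<open>Vertex deletion\<close>

text \<open>The inverse of the relabelling that closes the gap after vertex \<open>w\<close> has been deleted.\<close>

definition skip :: "nat \<Rightarrow> nat \<Rightarrow> nat" where
  "skip w a = (if a < w then a else Suc a)"

definition del :: "nat \<Rightarrow> (nat \<times> nat) set \<Rightarrow> (nat \<times> nat) set" where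
  "del w E = {(a, b). (skip w a, skip w b) \<in> E}"

definition pairs :: "nat \<Rightarrow> (nat \<times> nat) set" where
  "pairs n = {(a, b). 1 \<le> a \<and> a < b \<and> b \<le> n}"

lemma finite_pairs [simp]: "finite (pairs n)"
  by (rule finite_subset[of _ "{1..n} \<times> {1..n}"]) (auto simp: pairs_def)

lemma skip_less_iff [simp]: "skip w a < skip w b \<longleftrightarrow> a < b"
  by (auto simp: skip_def)

lemma skip_eq_iff [simp]: "skip w a = skip w b \<longleftrightarrow> a = b"
  by (auto simp: skip_def)

lemma skip_le_iff [simp]: "skip w a \<le> skip w b \<longleftrightarrow> a \<le> b"
  by (auto simp: skip_def)

lemma skip_neq [simp]: "skip w a \<noteq> w"
  by (auto simp: skip_def)

lemma skip_surj: "a \<noteq> w \<Longrightarrow> a \<ge> 1 \<Longrightarrow> \<exists>a'. skip w a' = a"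
  by (rule exI[of _ "if a < w then a else a - 1"]) (auto simp: skip_def)

lemma skip_range:
  assumes "w \<in> {1..Suc m}"
  shows "skip w a \<in> {1..Suc m} \<longleftrightarrow> a \<in> {1..m}"
  using assms by (auto simp: skip_def)

lemma del_pairs:
  assumes "w \<in> {1..Suc m}" "E \<subseteq> pairs (Suc m)"
  shows "del w E \<subseteq> pairs m"
  using assms by (force simp: del_def pairs_def skip_def split: if_splits)

text \<open>\<open>skip w\<close> is strictly increasing, so pairs lexicographically above
  \<open>(a, b)\<close> are carried to pairs above its image.\<close>

lemma splits_del:
  assumes "splits (skip w a, skip w b) X Y"
  shows "splits (a, b) (del w X) (del w Y)"
  using assms by (auto simp: splits_def del_def)

text \<open>
  Induction on \<open>n\<close>: \<open>J\<close> collects the vertices that are lost when the edges at the last vertex are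
  dropped, and these edges are made up for by the shadow pairs with upper endpoint \<open>n\<close>, counted
  by \<open>K\<close>. The two correction terms are needed for the induction and cost 2 in the end.
\<close>

lemma card_shadow:
  assumes "M \<subseteq> pairs n"
  shows "card (fst ` M \<union> snd ` M) \<le>
    card (\<Union>w\<in>{1..n}. del w M) + of_bool (1 \<in> fst ` M \<union> snd ` M) + of_bool (n \<in> fst ` M \<union> snd ` M)"
  using assms
proof (induction n arbitrary: M)
  case 0
  then have "M = {}" by (auto simp: pairs_def)
  then show ?case by simp
next
  case (Suc n)
  define V where "V M = fst ` M \<union> snd ` M" for M :: "(nat \<times> nat) set"
  define sh where "sh n M = (\<Union>w\<in>{1..n}. del w M)" for n M
  define M1 where "M1 = {e \<in> M. snd e \<le> n}"
  define J where "J = {a. (a, Suc n) \<in> M} - V M1"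
  define K where "K = {a. (a, n) \<in> sh (Suc n) M}"
  have finM: "finite M"
    by (rule finite_subset[OF Suc.prems finite_pairs])
  have M1: "M1 \<subseteq> pairs n"
    using Suc.prems by (auto simp: M1_def pairs_def)
  have IH: "card (V M1) \<le> card (sh n M1) + of_bool (1 \<in> V M1) + of_bool (n \<in> V M1)"
    using Suc.IH[OF M1] by (simp add: V_def sh_def)
  have finJ: "finite J"
    by (rule finite_subset[of _ "fst ` M"]) (force simp: J_def finM)+
  have finsh: "finite (sh (Suc n) M)"
    unfolding sh_def by (intro finite_UN_I finite_subset[OF del_pairs[OF _ Suc.prems] finite_pairs]) auto
  have finK: "finite K"
    by (rule finite_subset[of _ "fst ` sh (Suc n) M"]) (force simp: K_def finsh)+
  \<comment> \<open>Three sources of shadow pairs ending in \<open>n\<close>: deleting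
    \<open>Suc n\<close> keeps \<open>(a, n)\<close>, deleting \<open>n\<close> lowers only the
    upper endpoint of \<open>(a, Suc n)\<close>, and deleting 1 lowers both endpoints.\<close>
  have K1: "a \<in> K" if "(a, n) \<in> M" for a
  proof -
    have "(a, n) \<in> del (Suc n) M"
      using that Suc.prems by (auto simp: del_def skip_def pairs_def)
    then show ?thesis by (auto simp: K_def sh_def)
  qed
  have K2: "a \<in> K" if "(a, Suc n) \<in> M" "a < n" for a
  proof -
    have "(a, n) \<in> del n M" "n \<in> {1..Suc n}"
      using that by (auto simp: del_def skip_def)
    then show ?thesis unfolding K_def sh_def by blast
  qed
  have K3: "a - 1 \<in> K" if "(a, Suc n) \<in> M" "a \<noteq> 1" for a
  proof -
    have "(a - 1, n) \<in> del 1 M" "1 \<in> {1..Suc n}"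
      using that Suc.prems by (auto simp: del_def skip_def pairs_def)
    then show ?thesis unfolding K_def sh_def by blast
  qed
  have J1: "1 \<le> a" "a \<le> n" "(a, Suc n) \<in> M" "a \<notin> V M1" if "a \<in> J" for a
    using that Suc.prems by (auto simp: J_def pairs_def)
  \<comment> \<open>The term for \<open>n\<close> is the correction at the last vertex in
    \<open>IH\<close>; \<open>K\<close> has to absorb it.\<close>
  have key: "card J + of_bool (n \<in> V M1) \<le> card K + of_bool (1 \<in> J)"
  proof (cases "n \<in> V M1")
    case False
    have "inj_on (\<lambda>a. a - 1) (J - {1})"
      using J1(1) by (intro inj_onI) fastforce
    then have "card (J - {1}) \<le> card K"
      using J1(3) K3 finK by (intro card_inj_on_le[of "\<lambda>a. a - 1"]) auto
    then show ?thesis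
      using False finJ by (auto simp: card_Diff_singleton_if split: if_splits)
  next
    case True
    then obtain a0 where a0: "(a0, n) \<in> M"
      using M1 by (force simp: V_def M1_def pairs_def)
    have "n \<notin> J" using J1 True by blast
    then have "J \<subseteq> K"
      using J1 K2 by (metis le_neq_implies_less subsetI)
    show ?thesis
    proof (cases "1 \<in> J")
      case one: True
      then show ?thesis
        using card_mono[OF finK \<open>J \<subseteq> K\<close>] by simp
    next
      case one: False
      \<comment> \<open>One element of \<open>K\<close> outside \<open>J\<close> pays for the vertex
        \<open>n\<close>: the predecessor of \<open>Min J\<close>, or the partner \<open>a0\<close>
        of \<open>n\<close> if \<open>J\<close> is empty.\<close>
      have "\<exists>x. x \<in> K \<and> x \<notin> J"
      proof (cases "J = {}")
        case True
        then show ?thesis using K1[OF a0] by blast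
      next
        case False
        have mi: "Min J \<in> J" using finJ False by simp
        have "Min J - 1 \<in> K"
          using K3 J1(3)[OF mi] mi one by metis
        moreover have "Min J - 1 \<notin> J"
          using J1(1)[OF mi] Min_le[OF finJ, of "Min J - 1"] by fastforce
        ultimately show ?thesis by blast
      qed
      then have "J \<subset> K" using \<open>J \<subseteq> K\<close> by blast
      from psubset_card_mono[OF finK this] show ?thesis
        using True by simp
    qed
  qed
  have "card (sh n M1) + card K \<le> card (sh (Suc n) M)"
  proof -
    have "sh n M1 \<subseteq> sh (Suc n) M"
      by (force simp: sh_def del_def M1_def)
    moreover have "(\<lambda>a. (a, n)) ` K \<subseteq> sh (Suc n) M"
      by (auto simp: K_def)
    \<comment> \<open>For \<open>w \<le> n\<close>, \<open>skip w n = Suc n\<close> exceeds every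
      endpoint in \<open>M1\<close>, so no pair in \<open>sh n M1\<close> ends in
      \<open>n\<close>.\<close>
    moreover have "sh n M1 \<inter> (\<lambda>a. (a, n)) ` K = {}"
      by (auto simp: sh_def del_def M1_def skip_def split: if_splits)
    moreover have "card ((\<lambda>a. (a, n)) ` K) = card K"
      by (rule card_image) (auto simp: inj_on_def)
    ultimately show ?thesis
      by (metis (no_types, lifting) Un_least card_Un_disjoint card_mono finite_subset finsh)
  qed
  moreover have "card (V M) \<le> card (V M1) + card J + of_bool (Suc n \<in> V M)"
  proof -
    have finV: "finite (V M1)" by (simp add: V_def M1_def finM)
    have "V M \<subseteq> V M1 \<union> J \<union> (if Suc n \<in> V M then {Suc n} else {})"
    proof
      fix v assume "v \<in> V M"
      then obtain a b where ab: "(a, b) \<in> M" "v = a \<or> v = b"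
        by (auto simp: V_def)
      have "b \<le> n \<or> b = Suc n" using ab(1) Suc.prems by (auto simp: pairs_def)
      then show "v \<in> V M1 \<union> J \<union> (if Suc n \<in> V M then {Suc n} else {})"
      proof
        assume "b \<le> n"
        then have "(a, b) \<in> M1" using ab(1) by (simp add: M1_def)
        then show ?thesis using ab(2) by (force simp: V_def)
      next
        assume b: "b = Suc n"
        then have "Suc n \<in> V M" using ab(1) by (force simp: V_def)
        then show ?thesis using ab b by (auto simp: J_def)
      qed
    qed
    then have "card (V M) \<le> card (V M1 \<union> J \<union> (if Suc n \<in> V M then {Suc n} else {}))"
      using finV finJ by (intro card_mono) auto
    also have "\<dots> \<le> card (V M1) + card J + card (if Suc n \<in> V M then {Suc n} else {})"
      by (meson add_le_mono1 card_Un_le order_trans)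
    finally show ?thesis by (simp split: if_splits)
  qed
  \<comment> \<open>\<open>J\<close> avoids \<open>V M1\<close>, so the corrections at vertex 1 from
    \<open>IH\<close> and from \<open>key\<close> never occur together.\<close>
  moreover have "of_bool (1 \<in> V M1) + of_bool (1 \<in> J) \<le> (of_bool (1 \<in> V M) :: nat)"
  proof -
    have "1 \<in> V M" if "1 \<in> V M1"
      using that by (auto simp: V_def M1_def)
    moreover have "1 \<in> V M \<and> 1 \<notin> V M1" if "1 \<in> J"
      using J1(3,4)[OF that] by (force simp: V_def)
    ultimately show ?thesis by (simp add: of_bool_def)
  qed
  ultimately have "card (V M) \<le> card (sh (Suc n) M) + of_bool (1 \<in> V M) + of_bool (Suc n \<in> V M)"
    using IH key by linarith
  then show ?case by (simp add: V_def sh_def)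
qed

text \<open>The graph-free core: \<open>T\<close> may be any finite family containing all deletions,
  and later consists of the edge sets at level \<open>m\<close>.\<close>

lemma card_le_card_shadow:
  assumes F: "F \<subseteq> Pow (pairs (Suc m))"
    and T: "finite T" "\<And>w E. w \<in> {1..Suc m} \<Longrightarrow> E \<in> F \<Longrightarrow> del w E \<in> T"
    and small: "card T < m"
  shows "card F \<le> card T"
proof (cases "\<exists>w\<in>{1..Suc m}. inj_on (del w) F")
  case True
  then show ?thesis
    using T card_inj_on_le by (metis image_subsetI)
next
  case False
  define M where "M = branch F"
  have fin: "finite E" if "E \<in> F" for E
    using F that by (intro finite_subset[OF _ finite_pairs]) auto
  have M: "M \<subseteq> pairs (Suc m)"
    using F by (auto simp: M_def branch_def splits_def)
  have cover: "w \<in> fst ` M \<union> snd ` M" if w: "w \<in> {1..Suc m}" for w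
  proof -
    from False w obtain X Y where XY: "X \<in> F" "Y \<in> F" "X \<noteq> Y" "del w X = del w Y"
      unfolding inj_on_def by blast
    then obtain e where e: "splits e X Y"
      using splits_ex fin by metis
    obtain a b where ab: "e = (a, b)" by (cases e)
    have "e \<in> M" using e XY by (auto simp: M_def branch_def)
    then have ge: "1 \<le> a" "1 \<le> b" using M ab by (auto simp: pairs_def)
    \<comment> \<open>Otherwise \<open>e\<close> survives the deletion of \<open>w\<close> and
      splits two equal sets.\<close>
    have "a = w \<or> b = w"
    proof (rule ccontr)
      assume "\<not> (a = w \<or> b = w)"
      then obtain a' b' where "skip w a' = a" "skip w b' = b"
        using skip_surj ge by metis
      then have "splits (a', b') (del w X) (del w Y)"
        using splits_del e ab by blast
      then show False using XY(4) splits_irrefl by metis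
    qed
    then show ?thesis using \<open>e \<in> M\<close> ab by force
  qed
  have "F \<noteq> {}" using False by auto
  then have "T \<noteq> {}" using T(2)[of 1] by fastforce
  have V: "fst ` M \<union> snd ` M = {1..Suc m}"
  proof
    show "fst ` M \<union> snd ` M \<subseteq> {1..Suc m}"
      using M by (auto simp: pairs_def)
  qed (use cover in blast)
  have "(\<Union>w\<in>{1..Suc m}. del w M) \<subseteq> branch T"
  proof safe
    fix w a b assume w: "w \<in> {1..Suc m}" and "(a, b) \<in> del w M"
    then obtain X Y where "X \<in> F" "Y \<in> F" "splits (skip w a, skip w b) X Y"
      by (auto simp: del_def M_def branch_def)
    then show "(a, b) \<in> branch T"
      using splits_del T(2)[OF w] unfolding branch_def by blast
  qed
  then have "card (\<Union>w\<in>{1..Suc m}. del w M) < card T"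
    using card_branch_less[OF T(1) \<open>T \<noteq> {}\<close>] card_mono order.strict_trans1 by metis
  \<comment> \<open>All \<open>m + 1\<close> vertices are covered, so the shadow has at least
    \<open>m + 1 - 2\<close> pairs; hence \<open>card T \<ge> m\<close>, against
    \<open>small\<close>.\<close>
  then show ?thesis
    using card_shadow[OF M] small unfolding V by simp
qed

section \<open>Levels of hereditary properties\<close>

definition edges :: "nat ordered_graph \<Rightarrow> (nat \<times> nat) set" where
  "edges X = {(a, b). (a, b) \<in> parcs (fst X) \<and> a < b}"

lemma pair_graph_iff:
  "pair_graph G \<longleftrightarrow> finite (pverts G) \<and> parcs G \<subseteq> pverts G \<times> pverts G \<and> sym (parcs G) \<and> irrefl (parcs G)"
proof
  assume "pair_graph G"
  then interpret pair_graph G .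
  show "finite (pverts G) \<and> parcs G \<subseteq> pverts G \<times> pverts G \<and> sym (parcs G) \<and> irrefl (parcs G)"
    using pair_finite_verts in_arcsD1 in_arcsD2 pair_sym_arcs pair_no_loops
    by (fastforce simp: symmetric_def irrefl_def)
next
  assume "finite (pverts G) \<and> parcs G \<subseteq> pverts G \<times> pverts G \<and> sym (parcs G) \<and> irrefl (parcs G)"
  then show "pair_graph G"
    by unfold_locales (auto simp: symmetric_def irrefl_def intro: finite_subset)
qed

lemma levelD:
  assumes "hereditary_property P" "X \<in> level P n"
  shows "pair_graph (fst X)" "pverts (fst X) = {1..n}"
    "snd X = {(i, j). i \<in> {1..n} \<and> j \<in> {1..n} \<and> i \<le> j}" "X \<in> P"
proof -
  show XP: "X \<in> P"
    and "pverts (fst X) = {1..n}" "snd X = {(i, j). i \<in> {1..n} \<and> j \<in> {1..n} \<and> i \<le> j}"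
    using assms(2) by (auto simp: level_def)
  have "is_ordered_graph X"
    using assms(1) XP unfolding hereditary_property_def by blast
  then show "pair_graph (fst X)"
    by (simp add: is_ordered_graph_def case_prod_beta)
qed

lemma edges_subset_pairs:
  assumes "hereditary_property P" "X \<in> level P n"
  shows "edges X \<subseteq> pairs n"
  using levelD[OF assms] by (fastforce simp: edges_def pairs_def pair_graph_iff)

text \<open>A symmetric irreflexive relation is recovered from its ascending half, and the level
  fixes the vertices and the order.\<close>

lemma inj_on_edges:
  assumes "hereditary_property P"
  shows "inj_on edges (level P n)"
proof (rule inj_onI)
  fix X Y assume X: "X \<in> level P n" and Y: "Y \<in> level P n" and eq: "edges X = edges Y"
  have arcs: "parcs (fst Z) = edges Z \<union> (edges Z)\<inverse>" if "Z \<in> level P n" for Z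
  proof -
    have sym: "sym (parcs (fst Z))" and irrefl: "irrefl (parcs (fst Z))"
      using levelD(1)[OF assms that] by (auto simp: pair_graph_iff)
    have "(a, b) \<in> parcs (fst Z) \<longleftrightarrow> (a, b) \<in> edges Z \<union> (edges Z)\<inverse>" for a b
      using sym irrefl by (cases a b rule: linorder_cases) (auto simp: edges_def irrefl_def dest: symD)
    then show ?thesis by auto
  qed
  have "fst X = fst Y"
    using arcs[OF X] arcs[OF Y] eq levelD(2)[OF assms X] levelD(2)[OF assms Y]
    by (simp add: pair_pre_digraph.equality)
  then show "X = Y"
    using levelD(3)[OF assms X] levelD(3)[OF assms Y] by (simp add: prod_eq_iff)
qed

text \<open>Heredity yields the induced subgraph \<open>H\<close> that misses \<open>w\<close>;
  closure under isomorphism yields its copy \<open>K\<close> on \<open>{1..m}\<close>.\<close>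

lemma del_edges_level:
  assumes P: "hereditary_property P" and X: "X \<in> level P (Suc m)" and w: "w \<in> {1..Suc m}"
  shows "del w (edges X) \<in> edges ` level P m"
proof -
  obtain G r where Gr: "X = (G, r)" by (cases X)
  have pv: "pverts G = {1..Suc m}"
    and r: "r = {(i, j). i \<in> {1..Suc m} \<and> j \<in> {1..Suc m} \<and> i \<le> j}"
    and pgG: "pair_graph G"
    using levelD[OF P X] by (auto simp: Gr)
  define W where "W = {1..Suc m} - {w}"
  define H where "H = \<lparr>pverts = W, parcs = Restr (parcs G) W\<rparr>"
  define K where "K = \<lparr>pverts = {1..m}, parcs = {(a, b). (skip w a, skip w b) \<in> parcs G}\<rparr>"
  define t where "t = {(i, j). i \<in> {1..m} \<and> j \<in> {1..m} \<and> i \<le> j}"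
  have pgH: "pair_graph H"
    using pgG by (auto simp: pair_graph_iff H_def W_def irrefl_def sym_def)
  have pgK: "pair_graph K"
    using pgG skip_range[OF w] by (auto simp: pair_graph_iff K_def irrefl_def sym_def pv)
  have "wf_digraph (with_proj F)" if "pair_graph F" for F :: "nat pair_pre_digraph"
  proof -
    interpret pair_graph F by fact
    show ?thesis by unfold_locales
  qed
  then have "induced_subgraph (with_proj H) (with_proj G)"
    using pgG pgH by (auto simp: induced_subgraph_def subgraph_def compatible_def H_def W_def pv)
  then have "induced_ordered_subgraph (H, Restr r W) (G, r)"
    by (simp add: induced_ordered_subgraph_def H_def)
  then have HP: "(H, Restr r W) \<in> P"
    using P levelD(4)[OF P X] unfolding hereditary_property_def Gr by blast
  have "linear_order_on {1..m} t"
    by (auto simp: t_def linear_order_on_def partial_order_on_def preorder_on_def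
        refl_on_def total_on_def intro!: transI antisymI)
  then have "is_ordered_graph (K, t)"
    using pgK by (simp add: is_ordered_graph_def K_def)
  moreover have "ordered_graph_iso (H, Restr r W) (K, t)"
  proof -
    have bij: "bij_betw (skip w) {1..m} W"
    proof (rule bij_betwI')
      show "\<exists>a\<in>{1..m}. b = skip w a" if b: "b \<in> W" for b
      proof -
        obtain a where "skip w a = b"
          using skip_surj[of b w] b by (auto simp: W_def)
        then show ?thesis using b skip_range[OF w, of a] by (auto simp: W_def)
      qed
      show "skip w a \<in> W" if "a \<in> {1..m}" for a
        using that skip_range[OF w, of a] by (simp add: W_def)
    qed simp
    \<comment> \<open>The inverse of \<open>skip w\<close> closes the gap at \<open>w\<close>; it is
      monotone because \<open>skip w\<close> reflects the order.\<close>
    define f where "f = the_inv_into {1..m} (skip w)"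
    have f: "bij_betw f W {1..m}"
      unfolding f_def by (rule bij_betw_the_inv_into[OF bij])
    have skip_f: "skip w (f u) = u" if "u \<in> W" for u
      unfolding f_def using f_the_inv_into_f_bij_betw[OF bij] that by blast
    have f_in: "f u \<in> {1..m}" if "u \<in> W" for u
      using f that by (auto simp: bij_betw_def)
    have f_le: "f u \<le> f v \<longleftrightarrow> u \<le> v" if "u \<in> W" "v \<in> W" for u v
      using skip_le_iff[of w "f u" "f v"] skip_f that by simp
    have "\<forall>u\<in>W. \<forall>v\<in>W. ((u, v) \<in> parcs H \<longleftrightarrow> (f u, f v) \<in> parcs K) \<and>
        ((u, v) \<in> Restr r W \<longleftrightarrow> (f u, f v) \<in> t)"
      using skip_f f_in f_le by (auto simp: H_def K_def r t_def W_def)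
    then show ?thesis
      using f by (auto simp: ordered_graph_iso_def H_def K_def)
  qed
  ultimately have "(K, t) \<in> P"
    using P HP unfolding hereditary_property_def by blast
  then have "(K, t) \<in> level P m"
    by (simp add: level_def K_def t_def)
  moreover have "edges (K, t) = del w (edges X)"
    by (auto simp: edges_def del_def K_def Gr)
  ultimately show ?thesis by (metis imageI)
qed

lemma card_level_Suc_le:
  assumes P: "hereditary_property P" and small: "card (level P m) < m"
  shows "card (level P (Suc m)) \<le> card (level P m)"
proof -
  have c: "card (edges ` level P n) = card (level P n)" for n
    by (rule card_image) (rule inj_on_edges[OF P])
  have "card (edges ` level P (Suc m)) \<le> card (edges ` level P m)"
  proof (rule card_le_card_shadow)
    show "edges ` level P (Suc m) \<subseteq> Pow (pairs (Suc m))"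
      using edges_subset_pairs[OF P] by blast
  qed (use finite_level[OF P] del_edges_level[OF P] small c in auto)
  then show ?thesis by (simp only: c)
qed

theorem theorem1p2:
  fixes P :: "nat ordered_graph set" and k n :: nat
  assumes "hereditary_property P"
    and "k \<ge> 136" and "card (level P k) < k"
    and "n \<ge> k"
  shows "card (level P n) \<le> card (level P k)"
  using \<open>n \<ge> k\<close>
proof (induction n rule: dec_induct)
  case (step m)
  \<comment> \<open>The smallness condition persists:
    \<open>card (level P m) \<le> card (level P k) < k \<le> m\<close>.\<close>
  then have "card (level P (Suc m)) \<le> card (level P m)"
    using assms by (intro card_level_Suc_le) auto
  with step.IH show ?case by simp
qed simp

end
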